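(* Let $k$ be a finite field with $q$ elements, let $\psi$ be a non-trivial character of its additive group, let $(W,A)$ be a non-degenerate symplectic space over $k$ of even dimension $2m$, let $G=Sp(A)$, and let $L_o$ be a Lagrangian subspace of $W$. Then the cocycle $c(g,h)$ of the Weil representation $(V,\rho)$ of $G$ associated to $L_o$ is given by $$c(g,h)=|\mathcal S_{L_o}(gL_o,ghL_o)|^{-1}\,\mathcal S_{L_o}(gL_o,ghL_o)$$ for all $g,h\in G$.
   Context: $A:W\times W\to k$ is a non-degenerate alternating bilinear form and $Sp(A)$ its isometry group. A Lagrangian subspace is a maximal totally isotropic subspace. $|X|$ is the cardinality of a finite set $X$, and $|z|$ the modulus of a complex number $z$. For a Lagrangian $L$, $E_L$ is the complex vector space of all functions $f:W\to\mathbb C$ such that $f(x+y)=\psi(A(x,y))f(x)$ for all $x\in W$, $y\in L$. For $g\in G$, $\tau_g:E_L\to E_{gL}$ is $(\tau_g f)(x)=f(g^{-1}x)$. For Lagrangians $L,L'$, $\gamma_{L',L}:E_L\to E_{L'}$ is $$(\gamma_{L',L}f)(\omega)=\bigl(|L|\,|L\cap L'|\bigr)^{-1/2}\sum_{\zeta\in L'}\psi(-A(\omega,\zeta))\,f(\omega+\zeta)\qquad(\omega\in W).$$ The Weil representation $(V,\rho)$ associated to $L_o$ is the projective representation of $G$ obtained by contracting the bundle $(E_L)_L$ onto its fibre $V=E_{L_o}$ by means of the connection $(\gamma_{L',L})$: $g\in G$ acts on $E_{L_o}$ by $\tau_g$ followed by transport back from $E_{gL_o}$ to $E_{L_o}$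 by $\gamma_{L_o,gL_o}$. Its cocycle $c$ is the scalar-valued function on $G\times G$ measuring the failure of multiplicativity, i.e. the scalar factor by which $\rho_{gh}$ and $\rho_g\rho_h$ differ. For Lagrangians $L,L',L''$, the geometric Gauss sum is $$\mathcal S_L(L',L'')=\sum_{\zeta\in L\cap(L'+L'')}\psi(A(\zeta',\zeta'')),$$ where $\zeta=\zeta'+\zeta''$ with $\zeta'\in L'$, $\zeta''\in L''$ (the value $A(\zeta',\zeta'')$ does not depend on the chosen decomposition).
   Formalization: The number q of elements of k is assumed odd: for q even and m ≥ 1, the transport between transverse Lagrangians has rank one, so ρ is not a projective representation and, with gL_o transverse to L_o and h = g^{-1}, no scalar c(g,h) exists. *)

theory Defs
  imports Complex_Main "HOL-Library.Cardinality"
begin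

definition additive_character :: "('k::ring_1 \<Rightarrow> complex) \<Rightarrow> bool" where
  "additive_character \<psi> \<longleftrightarrow> (\<forall>s t. \<psi> (s + t) = \<psi> s * \<psi> t) \<and> \<psi> 0 = 1"

definition nontrivial_additive_character :: "('k::ring_1 \<Rightarrow> complex) \<Rightarrow> bool" where
  "nontrivial_additive_character \<psi> \<longleftrightarrow> additive_character \<psi> \<and> (\<exists>t. \<psi> t \<noteq> 1)"

locale symplectic_space = vector_space scale
  for scale :: "'k::field \<Rightarrow> 'w::ab_group_add \<Rightarrow> 'w" +
  fixes A :: "'w \<Rightarrow> 'w \<Rightarrow> 'k"
  assumes linear_left: "\<And>y. Vector_Spaces.linear scale (*) (\<lambda>x. A x y)"
    and linear_right: "\<And>x. Vector_Spaces.linear scale (*) (A x)"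
    and alternating: "\<And>x. A x x = 0"
    and nondegenerate: "\<And>x. (\<forall>y. A x y = 0) \<Longrightarrow> x = 0"

definition Sp :: "('k::field \<Rightarrow> 'w::ab_group_add \<Rightarrow> 'w) \<Rightarrow> ('w \<Rightarrow> 'w \<Rightarrow> 'k) \<Rightarrow> ('w \<Rightarrow> 'w) set" where
  "Sp scale A =
    {g. Vector_Spaces.linear scale scale g \<and> bij g \<and> (\<forall>x y. A (g x) (g y) = A x y)}"

definition totally_isotropic ::
  "('k::field \<Rightarrow> 'w::ab_group_add \<Rightarrow> 'w) \<Rightarrow> ('w \<Rightarrow> 'w \<Rightarrow> 'k) \<Rightarrow> 'w set \<Rightarrow> bool" where
  "totally_isotropic scale A L \<longleftrightarrow>
    module.subspace scale L \<and> (\<forall>x\<in>L. \<forall>y\<in>L. A x y = 0)"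

definition lagrangian ::
  "('k::field \<Rightarrow> 'w::ab_group_add \<Rightarrow> 'w) \<Rightarrow> ('w \<Rightarrow> 'w \<Rightarrow> 'k) \<Rightarrow> 'w set \<Rightarrow> bool" where
  "lagrangian scale A L \<longleftrightarrow>
    totally_isotropic scale A L \<and>
    (\<forall>M. totally_isotropic scale A M \<and> L \<subseteq> M \<longrightarrow> M = L)"

definition fibre ::
  "('w::ab_group_add \<Rightarrow> 'w \<Rightarrow> 'k) \<Rightarrow> ('k \<Rightarrow> complex) \<Rightarrow> 'w set \<Rightarrow> ('w \<Rightarrow> complex) set" where
  "fibre A \<psi> L = {f. \<forall>x. \<forall>y\<in>L. f (x + y) = \<psi> (A x y) * f x}"

definition translate :: "('w \<Rightarrow> 'w) \<Rightarrow> ('w \<Rightarrow> complex) \<Rightarrow> ('w \<Rightarrow> complex)" where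
  "translate g f = (\<lambda>x. f (inv g x))"

text \<open>The order of the arguments \<open>L' L\<close> follows the subscripts of \<open>\<gamma>\<close>: transport
  goes from the fibre at \<open>L\<close> to the fibre at \<open>L'\<close>. The formula is written as a total operator
  on functions; only its values on \<open>fibre A \<psi> L\<close> are meaningful.\<close>

definition transport ::
  "('w::ab_group_add \<Rightarrow> 'w \<Rightarrow> 'k::field) \<Rightarrow> ('k \<Rightarrow> complex) \<Rightarrow> 'w set \<Rightarrow> 'w set
    \<Rightarrow> ('w \<Rightarrow> complex) \<Rightarrow> ('w \<Rightarrow> complex)" where
  "transport A \<psi> L' L f = (\<lambda>\<omega>.
    complex_of_real ((real (card L) * real (card (L \<inter> L'))) powr (- 1 / 2)) *
    (\<Sum>\<zeta>\<in>L'. \<psi> (- A \<omega> \<zeta>) * f (\<omega> + \<zeta>)))"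

definition weil_rep ::
  "('w::ab_group_add \<Rightarrow> 'w \<Rightarrow> 'k::field) \<Rightarrow> ('k \<Rightarrow> complex) \<Rightarrow> 'w set
    \<Rightarrow> ('w \<Rightarrow> 'w) \<Rightarrow> ('w \<Rightarrow> complex) \<Rightarrow> ('w \<Rightarrow> complex)" where
  "weil_rep A \<psi> Lo g f = transport A \<psi> Lo (g ` Lo) (translate g f)"

text \<open>Convention: the cocycle \<open>c\<close> is normalised by \<open>\<rho>\<^sub>g\<^sub>h = c(g,h) \<rho>\<^sub>g \<rho>\<^sub>h\<close> on \<open>V\<close>. With the opposite
  normalisation the Gauss sum would have to be replaced by its complex conjugate.\<close>

definition multiplicativity_defect ::
  "('w::ab_group_add \<Rightarrow> 'w \<Rightarrow> 'k::field) \<Rightarrow> ('k \<Rightarrow> complex) \<Rightarrow> 'w set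
    \<Rightarrow> ('w \<Rightarrow> 'w) \<Rightarrow> ('w \<Rightarrow> 'w) \<Rightarrow> complex \<Rightarrow> bool" where
  "multiplicativity_defect A \<psi> Lo g h z \<longleftrightarrow>
    (\<forall>f \<in> fibre A \<psi> Lo. \<forall>x.
      weil_rep A \<psi> Lo (g \<circ> h) f x = z * weil_rep A \<psi> Lo g (weil_rep A \<psi> Lo h f) x)"

definition weil_cocycle ::
  "('w::ab_group_add \<Rightarrow> 'w \<Rightarrow> 'k::field) \<Rightarrow> ('k \<Rightarrow> complex) \<Rightarrow> 'w set
    \<Rightarrow> ('w \<Rightarrow> 'w) \<Rightarrow> ('w \<Rightarrow> 'w) \<Rightarrow> complex" where
  "weil_cocycle A \<psi> Lo g h = (THE z. multiplicativity_defect A \<psi> Lo g h z)"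

definition decomposition_pairing ::
  "('w::ab_group_add \<Rightarrow> 'w \<Rightarrow> 'k) \<Rightarrow> 'w set \<Rightarrow> 'w set \<Rightarrow> 'w \<Rightarrow> 'k" where
  "decomposition_pairing A L' L'' \<zeta> =
    (THE t. \<exists>\<zeta>'\<in>L'. \<exists>\<zeta>''\<in>L''. \<zeta> = \<zeta>' + \<zeta>'' \<and> t = A \<zeta>' \<zeta>'')"

definition gauss_sum ::
  "('w::ab_group_add \<Rightarrow> 'w \<Rightarrow> 'k) \<Rightarrow> ('k \<Rightarrow> complex) \<Rightarrow> 'w set \<Rightarrow> 'w set \<Rightarrow> 'w set \<Rightarrow> complex" where
  "gauss_sum A \<psi> L L' L'' =
    (\<Sum>\<zeta> \<in> L \<inter> {\<zeta>' + \<zeta>'' | \<zeta>' \<zeta>''. \<zeta>' \<in> L' \<and> \<zeta>'' \<in> L''}. \<psi> (decomposition_pairing A L' L'' \<zeta>))"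

lemma (in symplectic_space) decomposition_pairing_eq:
  assumes L': "totally_isotropic scale A L'" and L'': "totally_isotropic scale A L''"
    and mem: "\<zeta>' \<in> L'" "\<zeta>'' \<in> L''"
  shows "decomposition_pairing A L' L'' (\<zeta>' + \<zeta>'') = A \<zeta>' \<zeta>''"
  unfolding decomposition_pairing_def
proof (rule the_equality)
  show "\<exists>u\<in>L'. \<exists>v\<in>L''. \<zeta>' + \<zeta>'' = u + v \<and> A \<zeta>' \<zeta>'' = A u v"
    using mem by blast
next
  fix t
  assume "\<exists>u\<in>L'. \<exists>v\<in>L''. \<zeta>' + \<zeta>'' = u + v \<and> t = A u v"
  then obtain u v where uv: "u \<in> L'" "v \<in> L''" "\<zeta>' + \<zeta>'' = u + v" "t = A u v"
    by blast
  define d where "d = u - \<zeta>'"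
  have d2: "d = \<zeta>'' - v"
    using uv(3) by (simp add: d_def algebra_simps)
  have dL': "d \<in> L'"
    using L' uv(1) mem(1) subspace_diff by (simp add: totally_isotropic_def d_def)
  have dL'': "d \<in> L''"
    using L'' uv(2) mem(2) subspace_diff by (simp add: totally_isotropic_def d2)
  interpret l: Vector_Spaces.linear scale "(*)" "\<lambda>x. A x v" by (rule linear_left)
  interpret r: Vector_Spaces.linear scale "(*)" "A \<zeta>'" by (rule linear_right)
  have "A u v = A (\<zeta>' + d) v" by (simp add: d_def)
  also have "\<dots> = A \<zeta>' v + A d v" by (rule l.add)
  also have "A d v = 0" using L'' dL'' uv(2) by (simp add: totally_isotropic_def)
  also have "A \<zeta>' v = A \<zeta>' \<zeta>'' - A \<zeta>' d" using r.diff[of \<zeta>'' d] by (simp add: d2)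
  also have "A \<zeta>' d = 0" using L' dL' mem(1) by (simp add: totally_isotropic_def)
  finally show "t = A \<zeta>' \<zeta>''" by (simp add: uv(4))
qed

end

theory Submission
  imports Defs "HOL-Number_Theory.Residues"
begin

text \<open>The operators \<open>(U\<^sub>a f)(x) = \<psi>(-A(x,a)) f(x + a)\<close> satisfy \<open>U\<^sub>a U\<^sub>b = \<psi>(-A(a,b)) U\<^sub>a\<^sub>+\<^sub>b\<close>,
  the fibre at \<open>L\<close> consists of the functions fixed by all \<open>U\<^sub>a\<close> with \<open>a \<in> L\<close>, and transport to it is a
  multiple of \<open>T\<^sub>L = (\<Sum>a\<in>L. U\<^sub>a)\<close>. On the fibre at \<open>N\<close>, the operator \<open>T\<^sub>L U\<^sub>b\<close> equals \<open>\<psi>(A(a,c)) T\<^sub>L\<close> if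
  \<open>b = a + c\<close> with \<open>a \<in> L\<close>, \<open>c \<in> N\<close>. Otherwise some \<open>d \<in> L \<inter> N\<close> has \<open>\<psi>(2A(d,b)) \<noteq> 1\<close>, because
  \<open>L + N = (L \<inter> N)\<^sup>\<bottom>\<close> and \<open>q\<close> is odd, and the operator vanishes. Hence \<open>T\<^sub>L T\<^sub>M = S\<^sub>M(L,N) T\<^sub>L\<close> on the fibre at \<open>N\<close>.
  The sum \<open>S\<^sub>M(L,N)\<close> is a positive multiple of the conjugate of \<open>S\<^sub>L(M,N)\<close>, and its modulus shows that the
  normalising factors leave only the phase.\<close>

text \<open>If 2 vanished, the characteristic would divide 2 and the order of the field, so it would
  be 2 and the order even.\<close>

lemma two_neq_zero_of_odd_CARD:
  assumes "odd CARD('k::{field,finite})"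
  shows "(2::'k) \<noteq> 0"
proof
  assume "(2::'k) = 0"
  then have "of_nat 2 = (0::'k)"
    by simp
  then have "CHAR('k) dvd 2"
    by (simp only: of_nat_eq_0_iff_char_dvd)
  moreover have "CHAR('k) dvd CARD('k)"
    by (rule CHAR_dvd_CARD)
  ultimately show False
    using assms CHAR_not_1[where 'a = 'k]
    by (metis One_nat_def prime_nat_iff two_is_prime_nat)
qed

locale finite_weil = symplectic_space scale A
  for scale :: "'k::{field,finite} \<Rightarrow> 'w::{ab_group_add,finite} \<Rightarrow> 'w"
    and A :: "'w \<Rightarrow> 'w \<Rightarrow> 'k" +
  fixes \<psi> :: "'k \<Rightarrow> complex"
  assumes nontriv: "nontrivial_additive_character \<psi>"
    and two_neq_zero: "(2::'k) \<noteq> 0"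
begin

section \<open>Bilinearity and skew symmetry of the form\<close>

lemma A_add_left: "A (x + y) z = A x z + A y z"
  using module_hom.add[OF linear_left[unfolded Vector_Spaces.linear_iff_module_hom]] by blast

lemma A_add_right: "A z (x + y) = A z x + A z y"
  using module_hom.add[OF linear_right[unfolded Vector_Spaces.linear_iff_module_hom]] by blast

lemma A_scale_left: "A (scale c x) z = c * A x z"
  using module_hom.scale[OF linear_left[unfolded Vector_Spaces.linear_iff_module_hom]] by blast

lemma A_scale_right: "A z (scale c x) = c * A z x"
  using module_hom.scale[OF linear_right[unfolded Vector_Spaces.linear_iff_module_hom]] by blast

lemma A_neg_left: "A (- x) z = - A x z"
  using module_hom.neg[OF linear_left[unfolded Vector_Spaces.linear_iff_module_hom]] by blast

lemma A_neg_right: "A z (- x) = - A z x"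
  using module_hom.neg[OF linear_right[unfolded Vector_Spaces.linear_iff_module_hom]] by blast

lemma A_diff_left: "A (x - y) z = A x z - A y z"
  using A_add_left[of x "- y"] by (simp add: A_neg_left)

lemma A_diff_right: "A z (x - y) = A z x - A z y"
  using A_add_right[of z x "- y"] by (simp add: A_neg_right)

lemma A_zero_left [simp]: "A 0 z = 0"
  using A_diff_left[of 0 0 z] by simp

lemma A_zero_right [simp]: "A z 0 = 0"
  using A_diff_right[of z 0 0] by simp

lemma A_skew: "A y x = - A x y"
proof -
  have "A x y + A y x = A (x + y) (x + y)"
    by (simp add: A_add_left A_add_right alternating[of x] alternating[of y] add.commute)
  then have "A x y + A y x = 0"
    by (simp only: alternating)
  then show ?thesis
    by (simp add: eq_neg_iff_add_eq_0 add.commute)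
qed

lemmas A_linear = A_add_left A_add_right A_diff_left A_diff_right A_neg_left A_neg_right

section \<open>Values of the additive character\<close>

lemma psi_add: "\<psi> (s + t) = \<psi> s * \<psi> t"
  using nontriv by (simp add: nontrivial_additive_character_def additive_character_def)

lemma psi_zero [simp]: "\<psi> 0 = 1"
  using nontriv by (simp add: nontrivial_additive_character_def additive_character_def)

text \<open>The order of the field annihilates its additive group, so every value is a root of
  unity.\<close>

lemma norm_psi [simp]: "cmod (\<psi> t) = 1"
proof -
  have "\<psi> t ^ n = \<psi> (of_nat n * t)" for n
    by (induction n) (simp_all add: psi_add distrib_right)
  moreover have "of_nat CARD('k) = (0::'k)"
    by (simp only: of_nat_eq_0_iff_char_dvd CHAR_dvd_CARD)
  ultimately have "\<psi> t ^ CARD('k) = 1"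
    by simp
  then have "cmod (\<psi> t) ^ CARD('k) = 1"
    by (metis norm_one norm_power)
  then show ?thesis
    by (auto dest: power_eq_1_iff)
qed

lemma psi_minus: "\<psi> (- t) = cnj (\<psi> t)"
proof -
  have "\<psi> t * \<psi> (- t) = 1"
    using psi_add[of t "- t"] by simp
  moreover have "\<psi> t * cnj (\<psi> t) = 1"
    by (simp add: complex_norm_square[symmetric])
  moreover have "\<psi> t \<noteq> 0"
    by (metis norm_psi norm_zero zero_neq_one)
  ultimately show ?thesis
    by (metis mult_left_cancel)
qed

text \<open>Multiplication by \<open>a\<close> is onto. When \<open>a\<close> is a value of
  \<open>A\<close>, the factor \<open>s\<close> can be absorbed by scaling a vector within a
  subspace.\<close>

lemma nontrivial_multiple:
  assumes "a \<noteq> 0"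
  shows "\<exists>s. \<psi> (s * a) \<noteq> 1"
proof -
  obtain t where "\<psi> t \<noteq> 1"
    using nontriv by (auto simp: nontrivial_additive_character_def)
  moreover have "t / a * a = t"
    using assms by simp
  ultimately show ?thesis
    by metis
qed

section \<open>Orthogonal complements and Lagrangians\<close>

definition perp :: "'w set \<Rightarrow> 'w set" where
  "perp U = {x. \<forall>u\<in>U. A u x = 0}"

lemma subspace_perp: "subspace (perp U)"
  by (auto simp: subspace_def perp_def A_add_right A_scale_right)

lemma character_sum_subspace:
  assumes U: "subspace U"
  shows "(\<Sum>u\<in>U. \<psi> (A u y)) = (if y \<in> perp U then of_nat (card U) else 0)"
proof (cases "y \<in> perp U")
  case True
  then show ?thesis
    by (simp add: perp_def)
next
  case False
  then obtain v where v: "v \<in> U" "A v y \<noteq> 0"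
    by (auto simp: perp_def)
  obtain s where s: "\<psi> (s * A v y) \<noteq> 1"
    using nontrivial_multiple v(2) by blast
  define w where "w = scale s v"
  have w: "w \<in> U" "\<psi> (A w y) \<noteq> 1"
    using s v(1) U by (simp_all add: w_def A_scale_left subspace_scale)
  \<comment> \<open>Translation by \<open>w\<close> permutes \<open>U\<close> and multiplies the sum
    by a factor other than 1, so the sum vanishes.\<close>
  have "(\<Sum>u\<in>U. \<psi> (A u y)) = (\<Sum>u\<in>U. \<psi> (A (u + w) y))"
    by (rule sum.reindex_bij_witness[of _ "\<lambda>u. u + w" "\<lambda>u. u - w"])
       (use w(1) U in \<open>auto simp: subspace_add subspace_diff\<close>)
  also have "\<dots> = (\<Sum>u\<in>U. \<psi> (A u y)) * \<psi> (A w y)"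
    by (simp add: A_add_left psi_add sum_distrib_right)
  finally have "(\<Sum>u\<in>U. \<psi> (A u y)) * (\<psi> (A w y) - 1) = 0"
    by (simp add: algebra_simps)
  then show ?thesis
    using w(2) False by simp
qed

lemma perp_UNIV: "perp UNIV = {0}"
proof -
  have "x = 0" if "\<forall>u. A u x = 0" for x
    using that nondegenerate[of x] by (simp add: A_skew[of _ x])
  then show ?thesis
    by (auto simp: perp_def)
qed

text \<open>Character sums replace dimension counting: for \<open>b\<close> in
  \<open>perp (perp U)\<close> but outside \<open>U\<close>, one double sum is 0 when summed over
  \<open>y\<close> first and \<open>card (perp U) * card U\<close> when summed over \<open>u\<close>
  first.\<close>

lemma perp_perp:
  assumes U: "subspace U"
  shows "perp (perp U) = U"
proof
  have "A y x = 0" if "A x y = 0" for x y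
    using A_skew[of y x] that by simp
  then show "U \<subseteq> perp (perp U)"
    unfolding perp_def by blast
  show "perp (perp U) \<subseteq> U"
  proof (rule subsetI, rule ccontr)
    fix b
    assume b: "b \<in> perp (perp U)" "b \<notin> U"
    have "(\<Sum>u\<in>U. \<Sum>y\<in>UNIV. \<psi> (A y (u - b))) = 0"
      using b(2) by (intro sum.neutral) (auto simp: character_sum_subspace perp_UNIV)
    moreover have "(\<Sum>u\<in>U. \<Sum>y\<in>UNIV. \<psi> (A y (u - b))) =
        (\<Sum>y\<in>UNIV. (\<Sum>u\<in>U. \<psi> (A u (- y))) * \<psi> (- A y b))"
    proof (subst sum.swap, rule sum.cong)
      fix y
      have "A y (u - b) = A u (- y) + - A y b" for u
        using A_skew[of y u] by (simp add: A_diff_right A_neg_right)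
      then show "(\<Sum>u\<in>U. \<psi> (A y (u - b))) = (\<Sum>u\<in>U. \<psi> (A u (- y))) * \<psi> (- A y b)"
        by (simp only: psi_add sum_distrib_right)
    qed simp
    moreover have "\<dots> = (\<Sum>y\<in>UNIV. if y \<in> perp U then of_nat (card U) else 0)"
    proof (rule sum.cong)
      fix y
      have "- y \<in> perp U \<longleftrightarrow> y \<in> perp U"
        by (simp add: perp_def A_neg_right)
      then show "(\<Sum>u\<in>U. \<psi> (A u (- y))) * \<psi> (- A y b) =
          (if y \<in> perp U then of_nat (card U) else 0)"
        using b(1) by (auto simp: character_sum_subspace[OF U] perp_def)
    qed simp
    moreover have "\<dots> = of_nat (card (perp U)) * of_nat (card U)"
      by (simp add: sum.If_cases)
    moreover have "card U \<noteq> 0" "card (perp U) \<noteq> 0"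
      using subspace_0[OF U] subspace_0[OF subspace_perp] by (auto simp: card_eq_0_iff)
    ultimately show False
      by simp
  qed
qed

text \<open>Adjoining to an isotropic subspace a vector orthogonal to it keeps it isotropic, because
  \<open>A\<close> is alternating; a maximal one thus contains its complement.\<close>

lemma lagrangian_iff_perp:
  "lagrangian scale A L \<longleftrightarrow> subspace L \<and> perp L = L"
proof
  assume L: "lagrangian scale A L"
  then have sub: "subspace L" and iso: "\<And>x y. x \<in> L \<Longrightarrow> y \<in> L \<Longrightarrow> A x y = 0"
    by (auto simp: lagrangian_def totally_isotropic_def)
  have "x \<in> L" if x: "x \<in> perp L" for x
  proof -
    define M where "M = {l + y | l y. l \<in> L \<and> y \<in> span {x}}"
    have "subspace M"
      unfolding M_def by (intro subspace_sums sub subspace_span)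
    moreover have "A l x = 0" "A x l = 0" if "l \<in> L" for l
      using x that A_skew[of x l] by (simp_all add: perp_def)
    then have "\<forall>u\<in>M. \<forall>v\<in>M. A u v = 0"
      by (auto simp: M_def span_singleton A_add_left A_add_right A_scale_left A_scale_right alternating iso)
    moreover have "L \<subseteq> M"
      unfolding M_def using span_zero by force
    ultimately have "M = L"
      using L by (simp add: lagrangian_def totally_isotropic_def)
    moreover have "x \<in> M"
      unfolding M_def using subspace_0[OF sub] span_base[of x "{x}"] by force
    ultimately show ?thesis
      by simp
  qed
  then show "subspace L \<and> perp L = L"
    using sub iso by (auto simp: perp_def)
next
  assume L: "subspace L \<and> perp L = L"
  then have "A x y = 0" if "x \<in> L" "y \<in> L" for x y
    using that by (auto simp: perp_def)
  moreover have "M = L" if "totally_isotropic scale A M" "L \<subseteq> M" for M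
  proof -
    have "M \<subseteq> perp L"
      using that by (auto simp: perp_def totally_isotropic_def)
    then show ?thesis
      using L that(2) by auto
  qed
  ultimately show "lagrangian scale A L"
    using L by (auto simp: lagrangian_def totally_isotropic_def)
qed

lemma lagrangian_subspace: "lagrangian scale A L \<Longrightarrow> subspace L"
  and lagrangian_isotropic: "lagrangian scale A L \<Longrightarrow> x \<in> L \<Longrightarrow> y \<in> L \<Longrightarrow> A x y = 0"
  and lagrangian_totally_isotropic: "lagrangian scale A L \<Longrightarrow> totally_isotropic scale A L"
  by (auto simp: lagrangian_def totally_isotropic_def)

text \<open>The complement of \<open>L + M\<close> is \<open>L \<inter> M\<close>, as both are their
  own complements; \<open>perp_perp\<close> inverts this.\<close>

lemma perp_Int_lagrangian:
  assumes "lagrangian scale A L" "lagrangian scale A M"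
  shows "perp (L \<inter> M) = {x + y | x y. x \<in> L \<and> y \<in> M}" (is "_ = ?S")
proof -
  have sub: "subspace L" "subspace M" and pL: "perp L = L" and pM: "perp M = M"
    using assms by (simp_all add: lagrangian_iff_perp)
  have "perp ?S = perp L \<inter> perp M"
  proof
    have "L \<subseteq> ?S" "M \<subseteq> ?S"
      using sub[THEN subspace_0] by force+
    then show "perp ?S \<subseteq> perp L \<inter> perp M"
      unfolding perp_def by blast
    show "perp L \<inter> perp M \<subseteq> perp ?S"
      by (auto simp: perp_def A_add_left)
  qed
  then have "perp (L \<inter> M) = perp (perp ?S)"
    by (simp add: pL pM)
  also have "\<dots> = ?S"
    by (intro perp_perp subspace_sums sub)
  finally show ?thesis .
qed

lemma Sp_lagrangian:
  assumes g: "g \<in> Sp scale A" and L: "lagrangian scale A L"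
  shows "lagrangian scale A (g ` L)"
proof -
  have lin: "Vector_Spaces.linear scale scale g" and bij: "bij g"
    and inv: "\<And>x y. A (g x) (g y) = A x y"
    using g by (auto simp: Sp_def)
  have "subspace (g ` L)"
    using module_hom.subspace_image[OF lin[unfolded Vector_Spaces.linear_iff_module_hom]]
      lagrangian_subspace[OF L] by blast
  moreover have "perp (g ` L) = g ` perp L"
  proof -
    have "g x \<in> perp (g ` L) \<longleftrightarrow> x \<in> perp L" for x
      by (simp add: perp_def inv)
    then have "perp L = g -` perp (g ` L)"
      by auto
    then show ?thesis
      using bij_is_surj[OF bij] by (simp add: surj_image_vimage_eq)
  qed
  ultimately show ?thesis
    using L by (simp add: lagrangian_iff_perp)
qed

section \<open>Heisenberg operators and their sums over Lagrangians\<close>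

definition heis :: "'w \<Rightarrow> ('w \<Rightarrow> complex) \<Rightarrow> 'w \<Rightarrow> complex" where
  "heis a f = (\<lambda>x. \<psi> (- A x a) * f (x + a))"

text \<open>The operator \<open>T\<^sub>L\<close>; for Lagrangian \<open>L\<close> it is
  \<open>card L\<close> times a projection onto the fibre at \<open>L\<close>.\<close>

definition smear :: "'w set \<Rightarrow> ('w \<Rightarrow> complex) \<Rightarrow> 'w \<Rightarrow> complex" where
  "smear L f = (\<lambda>x. \<Sum>a\<in>L. heis a f x)"

lemma heis_heis: "heis a (heis b f) = (\<lambda>x. \<psi> (- A a b) * heis (a + b) f x)"
proof
  fix x
  have "\<psi> (- A x a) * \<psi> (- A (x + a) b) = \<psi> (- A a b) * \<psi> (- A x (a + b))"
    unfolding psi_add[symmetric] by (simp add: A_linear algebra_simps)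
  then show "heis a (heis b f) x = \<psi> (- A a b) * heis (a + b) f x"
    by (simp add: heis_def add.assoc)
qed

lemma heis_scale: "heis a (\<lambda>x. c * f x) = (\<lambda>x. c * heis a f x)"
  by (simp add: heis_def mult.left_commute)

lemma smear_scale: "smear L (\<lambda>x. c * f x) = (\<lambda>x. c * smear L f x)"
  by (simp add: smear_def heis_scale sum_distrib_left)

lemma smear_sum: "smear L (\<lambda>x. \<Sum>i\<in>I. F i x) = (\<lambda>x. \<Sum>i\<in>I. smear L (F i) x)"
  unfolding smear_def heis_def sum_distrib_left by (rule ext, rule sum.swap)

lemma heis_fibre:
  assumes "f \<in> fibre A \<psi> L" "y \<in> L"
  shows "heis y f = f"
proof
  fix x
  have "heis y f x = \<psi> (- A x y) * (\<psi> (A x y) * f x)"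
    using assms by (simp add: heis_def fibre_def)
  also have "\<dots> = \<psi> (- A x y + A x y) * f x"
    by (simp only: psi_add mult.assoc)
  finally show "heis y f x = f x"
    by simp
qed

lemma fibre_of_heis_invariant:
  assumes "\<And>y. y \<in> L \<Longrightarrow> heis y f = f"
  shows "f \<in> fibre A \<psi> L"
  unfolding fibre_def
proof (intro CollectI allI ballI)
  fix x y
  assume y: "y \<in> L"
  have "\<psi> (A x y) * f x = \<psi> (A x y) * (\<psi> (- A x y) * f (x + y))"
    using fun_cong[OF assms[OF y], of x] by (simp add: heis_def)
  also have "\<dots> = \<psi> (A x y + - A x y) * f (x + y)"
    by (simp only: psi_add mult.assoc)
  finally show "f (x + y) = \<psi> (A x y) * f x"
    by simp
qed

text \<open>Isotropy removes the phase in \<open>heis_heis\<close>, so \<open>heis y\<close> merely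
  translates the index of summation.\<close>

lemma heis_smear:
  assumes L: "lagrangian scale A L" and y: "y \<in> L"
  shows "heis y (smear L f) = smear L f"
proof
  fix x
  have "heis y (smear L f) x = (\<Sum>a\<in>L. heis y (heis a f) x)"
    by (simp add: smear_def heis_def sum_distrib_left)
  also have "\<dots> = (\<Sum>a\<in>L. heis (y + a) f x)"
    by (simp add: heis_heis lagrangian_isotropic[OF L y])
  also have "\<dots> = smear L f x"
    unfolding smear_def
    by (rule sum.reindex_bij_witness[of _ "\<lambda>a. a - y" "\<lambda>a. y + a"])
       (use y lagrangian_subspace[OF L] in \<open>auto simp: subspace_add subspace_diff\<close>)
  finally show "heis y (smear L f) x = smear L f x" .
qed

lemma smear_heis:
  assumes L: "lagrangian scale A L" and y: "y \<in> L"
  shows "smear L (heis y f) = smear L f"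
proof
  fix x
  have "smear L (heis y f) x = (\<Sum>a\<in>L. heis (a + y) f x)"
    by (simp add: smear_def heis_heis lagrangian_isotropic[OF L _ y])
  also have "\<dots> = smear L f x"
    unfolding smear_def
    by (rule sum.reindex_bij_witness[of _ "\<lambda>a. a - y" "\<lambda>a. a + y"])
       (use y lagrangian_subspace[OF L] in \<open>auto simp: subspace_add subspace_diff\<close>)
  finally show "smear L (heis y f) x = smear L f x" .
qed

lemma smear_in_fibre: "lagrangian scale A L \<Longrightarrow> smear L f \<in> fibre A \<psi> L"
  by (rule fibre_of_heis_invariant) (rule heis_smear)

lemma smear_fibre: "f \<in> fibre A \<psi> L \<Longrightarrow> smear L f = (\<lambda>x. of_nat (card L) * f x)"
  by (simp add: smear_def heis_fibre)

text \<open>Splitting \<open>heis (a + c)\<close> into \<open>heis a\<close> after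
  \<open>heis c\<close> costs the phase; \<open>f\<close> absorbs \<open>heis c\<close> and
  \<open>smear L\<close> absorbs \<open>heis a\<close>.\<close>

lemma smear_heis_sum:
  assumes L: "lagrangian scale A L" and f: "f \<in> fibre A \<psi> M" and ac: "a \<in> L" "c \<in> M"
  shows "smear L (heis (a + c) f) = (\<lambda>x. \<psi> (A a c) * smear L f x)"
proof -
  have "heis (a + c) f = (\<lambda>x. \<psi> (A a c) * heis a (heis c f) x)"
    by (simp add: heis_heis mult.assoc[symmetric] psi_add[symmetric])
  then show ?thesis
    using smear_scale[of L "\<psi> (A a c)" "heis a f"] by (simp add: heis_fibre[OF f ac(2)] smear_heis[OF L ac(1)])
qed

lemma smear_heis_outside:
  assumes L: "lagrangian scale A L" and M: "lagrangian scale A M" and f: "f \<in> fibre A \<psi> M"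
    and b: "b \<notin> {x + y | x y. x \<in> L \<and> y \<in> M}"
  shows "smear L (heis b f) x = 0"
proof -
  have "b \<notin> perp (L \<inter> M)"
    using b perp_Int_lagrangian[OF L M] by simp
  then obtain v where v: "v \<in> L" "v \<in> M" "A v b \<noteq> 0"
    by (auto simp: perp_def)
  \<comment> \<open>The factor \<open>- 2\<close> anticipates the commutator phase of
    \<open>heis d\<close> and \<open>heis b\<close>; here 2 must be nonzero.\<close>
  obtain s where s: "\<psi> (s * (- 2 * A v b)) \<noteq> 1"
    using nontrivial_multiple[of "- 2 * A v b"] v(3) two_neq_zero by auto
  define d where "d = scale s v"
  have d: "d \<in> L" "d \<in> M"
    using v L M by (simp_all add: d_def lagrangian_subspace subspace_scale)
  \<comment> \<open>Moved past \<open>heis b\<close>, the operator \<open>heis d\<close> is absorbed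
    by \<open>f\<close>; in front of \<open>heis b\<close> it is absorbed by \<open>smear L\<close>.
    The commutator phase therefore fixes the result, which must be 0.\<close>
  have "heis d (heis b f) = (\<lambda>x. \<psi> (- A d b) * heis (b + d) f x)"
    by (simp add: heis_heis add.commute)
  also have "heis (b + d) f = (\<lambda>x. \<psi> (A b d) * heis b (heis d f) x)"
    by (simp add: heis_heis mult.assoc[symmetric] psi_add[symmetric])
  finally have "heis d (heis b f) = (\<lambda>x. \<psi> (- 2 * A d b) * heis b f x)"
    by (simp add: heis_fibre[OF f d(2)] mult.assoc[symmetric] psi_add[symmetric] A_skew[of b d])
  then have "smear L (heis b f) = (\<lambda>x. \<psi> (- 2 * A d b) * smear L (heis b f) x)"
    using smear_heis[OF L d(1), of "heis b f"] smear_scale by simp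
  then have "smear L (heis b f) x = \<psi> (- 2 * A d b) * smear L (heis b f) x"
    by (rule fun_cong)
  then have "(\<psi> (- 2 * A d b) - 1) * smear L (heis b f) x = 0"
    by (simp add: algebra_simps)
  moreover have "\<psi> (- 2 * A d b) \<noteq> 1"
    using s by (simp add: d_def A_scale_left mult.left_commute)
  ultimately show ?thesis
    by simp
qed

lemma smear_smear:
  assumes L: "lagrangian scale A L" and M: "lagrangian scale A M" and N: "lagrangian scale A N"
    and f: "f \<in> fibre A \<psi> N"
  shows "smear L (smear M f) = (\<lambda>x. gauss_sum A \<psi> M L N * smear L f x)"
proof
  fix x
  let ?S = "{x + y | x y. x \<in> L \<and> y \<in> N}"
  have "smear L (smear M f) x = (\<Sum>b\<in>M. smear L (heis b f) x)"
    unfolding smear_def[of M] by (simp add: smear_sum)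
  also have "\<dots> = (\<Sum>b\<in>M \<inter> ?S. smear L (heis b f) x)"
    by (rule sum.mono_neutral_right) (auto intro!: smear_heis_outside[OF L N f])
  also have "\<dots> = (\<Sum>b\<in>M \<inter> ?S. \<psi> (decomposition_pairing A L N b) * smear L f x)"
    by (rule sum.cong)
       (auto simp: smear_heis_sum[OF L f] decomposition_pairing_eq[OF L[THEN lagrangian_totally_isotropic]
            N[THEN lagrangian_totally_isotropic]])
  also have "\<dots> = gauss_sum A \<psi> M L N * smear L f x"
    by (simp add: gauss_sum_def sum_distrib_right)
  finally show "smear L (smear M f) x = gauss_sum A \<psi> M L N * smear L f x" .
qed

section \<open>Symmetries of the Gauss sum\<close>

lemma gauss_sum_same:
  assumes "lagrangian scale A L"
  shows "gauss_sum A \<psi> M L L = of_nat (card (L \<inter> M))"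
proof -
  have "{x + y | x y. x \<in> L \<and> y \<in> L} = L"
    using subspace_add[OF lagrangian_subspace[OF assms]] subspace_0[OF lagrangian_subspace[OF assms]]
    by force
  moreover have "decomposition_pairing A L L x = 0" if "x \<in> L" for x
    using decomposition_pairing_eq[OF assms[THEN lagrangian_totally_isotropic]
        assms[THEN lagrangian_totally_isotropic] that subspace_0[OF lagrangian_subspace[OF assms]]]
    by simp
  ultimately show ?thesis
    by (simp add: gauss_sum_def Int_commute)
qed

text \<open>The case \<open>N = L\<close> of \<open>smear_smear\<close>: a round trip from
  \<open>L\<close> through \<open>M\<close> acts as a scalar.\<close>

lemma smear_smear_fibre:
  assumes L: "lagrangian scale A L" and M: "lagrangian scale A M" and f: "f \<in> fibre A \<psi> L"
  shows "smear L (smear M f) = (\<lambda>x. of_nat (card (L \<inter> M) * card L) * f x)"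
  by (simp add: smear_smear[OF L M L f] gauss_sum_same[OF L] smear_fibre[OF f] mult.assoc)

text \<open>Exchanging the summands of a decomposition negates the pairing, and
  \<open>\<psi>\<close> turns negation into conjugation.\<close>

lemma gauss_sum_swap:
  assumes L: "lagrangian scale A L" and M: "lagrangian scale A M"
  shows "gauss_sum A \<psi> K M L = cnj (gauss_sum A \<psi> K L M)"
proof -
  note iso = L[THEN lagrangian_totally_isotropic] M[THEN lagrangian_totally_isotropic]
  have "{x + y | x y. x \<in> M \<and> y \<in> L} = {x + y | x y. x \<in> L \<and> y \<in> M}"
    by (metis add.commute)
  moreover have "decomposition_pairing A M L (x + y) = - decomposition_pairing A L M (x + y)"
    if "x \<in> L" "y \<in> M" for x y
    using decomposition_pairing_eq[OF iso that] decomposition_pairing_eq[OF iso(2,1) that(2,1)]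
    by (simp add: add.commute A_skew[of y x])
  ultimately show ?thesis
    unfolding gauss_sum_def cnj_sum by (intro sum.cong) (auto simp: psi_minus)
qed

text \<open>Each element of \<open>L \<inter> (M + N)\<close> has \<open>card (M \<inter> N)\<close> decompositions.\<close>

lemma gauss_sum_pairs:
  assumes M: "lagrangian scale A M" and N: "lagrangian scale A N"
  shows "of_nat (card (M \<inter> N)) * gauss_sum A \<psi> L M N =
    (\<Sum>(b, c)\<in>{(b, c). b \<in> M \<and> c \<in> N \<and> b + c \<in> L}. \<psi> (A b c))"
proof -
  let ?P = "{(b, c). b \<in> M \<and> c \<in> N \<and> b + c \<in> L}"
  let ?S = "L \<inter> {x + y | x y. x \<in> M \<and> y \<in> N}"
  let ?F = "\<lambda>z. {p \<in> ?P. fst p + snd p = z}"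
  note iso = M[THEN lagrangian_totally_isotropic] N[THEN lagrangian_totally_isotropic]
  note sM = lagrangian_subspace[OF M] and sN = lagrangian_subspace[OF N]
  have "(\<Sum>p\<in>?P. \<psi> (A (fst p) (snd p))) = (\<Sum>z\<in>?S. \<Sum>p\<in>?F z. \<psi> (A (fst p) (snd p)))"
    by (rule sum.group[symmetric]) (simp, simp, fastforce)
  also have "\<dots> = (\<Sum>z\<in>?S. of_nat (card (M \<inter> N)) * \<psi> (decomposition_pairing A M N z))"
  proof (rule sum.cong)
    fix z
    assume "z \<in> ?S"
    then obtain b c where z: "z = b + c" "b \<in> M" "c \<in> N" "b + c \<in> L"
      by auto
    \<comment> \<open>Two decompositions of \<open>z\<close> differ by a vector \<open>d\<close>
      moved from one summand to the other, which lies in both \<open>M\<close> and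
      \<open>N\<close>.\<close>
    have "bij_betw (\<lambda>d. (b + d, c - d)) (M \<inter> N) (?F z)"
    proof (rule bij_betw_byWitness[where f' = "\<lambda>p. fst p - b"])
      show "\<forall>p\<in>?F z. (b + (fst p - b), c - (fst p - b)) = p"
      proof
        fix p
        assume "p \<in> ?F z"
        then have "c = fst p + snd p - b"
          using z(1) by (simp add: algebra_simps)
        then show "(b + (fst p - b), c - (fst p - b)) = p"
          by simp
      qed
      show "(\<lambda>d. (b + d, c - d)) ` (M \<inter> N) \<subseteq> ?F z"
        using z sM sN by (auto simp: subspace_add subspace_diff)
      show "(\<lambda>p. fst p - b) ` ?F z \<subseteq> M \<inter> N"
      proof (rule image_subsetI)
        fix p
        assume p: "p \<in> ?F z"
        then have "fst p - b = c - snd p"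
          using z(1) by (auto simp: algebra_simps)
        moreover have "fst p \<in> M" "snd p \<in> N"
          using p by auto
        ultimately show "fst p - b \<in> M \<inter> N"
          using subspace_diff[OF sM _ z(2)] subspace_diff[OF sN z(3)] by (metis IntI)
      qed
    qed simp
    then have "card (?F z) = card (M \<inter> N)"
      by (rule bij_betw_same_card[symmetric])
    moreover have "\<psi> (A (fst p) (snd p)) = \<psi> (decomposition_pairing A M N z)" if "p \<in> ?F z" for p
      using that decomposition_pairing_eq[OF iso, of "fst p" "snd p"] by auto
    ultimately show "(\<Sum>p\<in>?F z. \<psi> (A (fst p) (snd p))) =
        of_nat (card (M \<inter> N)) * \<psi> (decomposition_pairing A M N z)"
      by simp
  qed simp
  finally show ?thesis
    by (simp add: gauss_sum_def sum_distrib_left case_prod_beta)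
qed

lemma gauss_sum_rotate:
  assumes L: "lagrangian scale A L" and M: "lagrangian scale A M" and N: "lagrangian scale A N"
  shows "of_nat (card (M \<inter> N)) * gauss_sum A \<psi> L M N =
    of_nat (card (L \<inter> N)) * cnj (gauss_sum A \<psi> M L N)"
proof -
  have "(\<Sum>(b, c)\<in>{(b, c). b \<in> M \<and> c \<in> N \<and> b + c \<in> L}. \<psi> (A b c)) =
      (\<Sum>(a, c)\<in>{(a, c). a \<in> L \<and> c \<in> N \<and> a + c \<in> M}. \<psi> (- A a c))"
    \<comment> \<open>The relation \<open>b + c = a\<close> is reread as
      \<open>a + (- c) = b\<close>; since \<open>A c c = 0\<close>, only the sign of the pairing
      changes.\<close>
    by (rule sum.reindex_bij_witness[of _ "\<lambda>(a, c). (a + c, - c)" "\<lambda>(b, c). (b + c, - c)"])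
       (use N[THEN lagrangian_subspace] in \<open>auto simp: subspace_neg A_linear alternating\<close>)
  also have "\<dots> = cnj (\<Sum>(a, c)\<in>{(a, c). a \<in> L \<and> c \<in> N \<and> a + c \<in> M}. \<psi> (A a c))"
    by (simp add: psi_minus case_prod_beta)
  finally show ?thesis
    by (simp add: gauss_sum_pairs[OF M N] gauss_sum_pairs[OF L N, symmetric])
qed

section \<open>Modulus of the Gauss sum\<close>

lemma fibre_nonzero:
  assumes L: "lagrangian scale A L"
  shows "\<exists>f\<in>fibre A \<psi> L. f 0 \<noteq> 0"
proof -
  \<comment> \<open>At 0 only the summand \<open>a = 0\<close> of \<open>smear L \<delta>\<close>
    survives.\<close>
  define \<delta> :: "'w \<Rightarrow> complex" where "\<delta> = (\<lambda>x. if x = 0 then 1 else 0)"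
  have "smear L \<delta> 0 = 1"
    using subspace_0[OF lagrangian_subspace[OF L]]
    by (simp add: smear_def heis_def \<delta>_def)
  then show ?thesis
    using smear_in_fibre[OF L, of \<delta>] by (intro bexI[of _ "smear L \<delta>"]) auto
qed

lemma card_Int_pos:
  assumes "lagrangian scale A L" "lagrangian scale A M"
  shows "card (L \<inter> M) > 0"
  using assms[THEN lagrangian_subspace, THEN subspace_0] by (auto simp: card_gt_0_iff)

lemma card_lagrangian_pos: "lagrangian scale A L \<Longrightarrow> card L > 0"
  using card_Int_pos[of L L] by simp

text \<open>Evaluating \<open>T\<^sub>L T\<^sub>M T\<^sub>N T\<^sub>M f\<close> in two ways, where \<open>T\<close> is \<^const>\<open>smear\<close> and \<open>f\<close> lies in the fibre of \<open>L\<close>.\<close>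

lemma norm_gauss_sum:
  assumes L: "lagrangian scale A L" and M: "lagrangian scale A M" and N: "lagrangian scale A N"
  shows "(cmod (gauss_sum A \<psi> M L N))\<^sup>2 * real (card (L \<inter> N)) =
    real (card M) * real (card (L \<inter> M)) * real (card (M \<inter> N))"
proof -
  let ?S = "gauss_sum A \<psi> M L N"
  obtain f where f: "f \<in> fibre A \<psi> L" "f 0 \<noteq> 0"
    using fibre_nonzero[OF L] by blast
  \<comment> \<open>Both visits to \<open>M\<close> are removed by \<open>smear_smear\<close>,
    leaving the round trip from \<open>L\<close> through \<open>N\<close>.\<close>
  have "smear L (smear M (smear N (smear M f))) 0 =
      ?S * (gauss_sum A \<psi> M N L * of_nat (card (L \<inter> N) * card L)) * f 0"
    by (simp add: smear_smear[OF L M N smear_in_fibre[OF N]] smear_smear[OF N M L f(1)] smear_scale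
        smear_smear_fibre[OF L N f(1)])
  \<comment> \<open>Grouped instead as a round trip from \<open>M\<close> through \<open>N\<close>
    followed by one from \<open>L\<close> through \<open>M\<close>.\<close>
  moreover have "smear L (smear M (smear N (smear M f))) 0 =
      of_nat (card (M \<inter> N) * card M) * of_nat (card (L \<inter> M) * card L) * f 0"
    by (simp add: smear_smear_fibre[OF M N smear_in_fibre[OF M]] smear_scale
        smear_smear_fibre[OF L M f(1)])
  \<comment> \<open>The second Gauss sum is the conjugate of \<open>?S\<close> by
    \<open>gauss_sum_swap\<close>.\<close>
  ultimately have "?S * cnj ?S * of_nat (card (L \<inter> N)) * of_nat (card L) =
      of_nat (card M) * of_nat (card (L \<inter> M)) * of_nat (card (M \<inter> N)) * of_nat (card L)"
    using f(2) by (auto simp: gauss_sum_swap[OF L N] mult_ac)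
  then have "?S * cnj ?S * of_nat (card (L \<inter> N)) =
      of_nat (card M) * of_nat (card (L \<inter> M)) * of_nat (card (M \<inter> N))"
    using card_lagrangian_pos[OF L] by auto
  then have "complex_of_real ((cmod ?S)\<^sup>2 * real (card (L \<inter> N))) =
      complex_of_real (real (card M) * real (card (L \<inter> M)) * real (card (M \<inter> N)))"
    by (simp add: complex_norm_square[symmetric])
  then show ?thesis
    by (simp only: of_real_eq_iff)
qed

section \<open>Composition of transports\<close>

lemma transport_eq_smear:
  "transport A \<psi> L' L f =
    (\<lambda>x. complex_of_real ((real (card L) * real (card (L \<inter> L'))) powr (- 1 / 2)) * smear L' f x)"
  by (simp add: transport_def smear_def heis_def)


lemma powr_minus_half: "x > 0 \<Longrightarrow> x powr (- 1 / 2) = 1 / sqrt x" for x :: real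
  using powr_minus_divide[of x "1/2"] by (simp add: powr_half_sqrt)

text \<open>Composition produces the scalar \<open>S'\<close>, while the statement involves
  \<open>S\<close>; rotation identifies their phases up to conjugation, and \<open>cmod S'\<close>
  is exactly the discrepancy of the normalising factors.\<close>

lemma transport_transport:
  assumes L: "lagrangian scale A L" and M: "lagrangian scale A M" and N: "lagrangian scale A N"
    and f: "f \<in> fibre A \<psi> N"
  defines "S \<equiv> gauss_sum A \<psi> L M N"
  shows "transport A \<psi> L N f x =
    inverse (complex_of_real (cmod S)) * S * transport A \<psi> L M (transport A \<psi> M N f) x"
proof -
  define S' where "S' = gauss_sum A \<psi> M L N"
  define p r t a n where "p = real (card (M \<inter> N))" and "r = real (card (L \<inter> N))"
    and "t = real (card (L \<inter> M))" and "a = real (card M)" and "n = real (card N)"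
  note sizes = p_def r_def t_def a_def n_def
  have pos: "p > 0" "r > 0" "t > 0" "a > 0" "n > 0"
    using card_Int_pos[OF M N] card_Int_pos[OF L N] card_Int_pos[OF L M]
      card_lagrangian_pos[OF M] card_lagrangian_pos[OF N] by (simp_all add: sizes)
  \<comment> \<open>\<open>S\<close> is a positive multiple of \<open>cnj S'\<close>, so multiplying
    \<open>S'\<close> by the phase of \<open>S\<close> gives \<open>cmod S'\<close>.\<close>
  have "p * S = r * cnj S'"
    using gauss_sum_rotate[OF L M N] by (simp add: S_def S'_def sizes)
  then have S: "S = complex_of_real (r / p) * cnj S'"
    using pos by (simp add: field_simps)
  have "(cmod S')\<^sup>2 * r = a * t * p"
    using norm_gauss_sum[OF L M N] by (simp add: S'_def sizes)
  then have "(cmod S')\<^sup>2 = a * t * p / r"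
    using pos by (simp add: field_simps)
  then have norm_S': "cmod S' = sqrt (a * t * p / r)"
    by (metis norm_ge_zero real_sqrt_unique)
  then have "S' \<noteq> 0"
    using pos by auto
  have "inverse (complex_of_real (cmod S)) * S * S' = (cnj S' * S') / cmod S'"
    using pos \<open>S' \<noteq> 0\<close> by (simp add: S norm_mult norm_divide field_simps)
  also have "\<dots> = cmod S'"
    using \<open>S' \<noteq> 0\<close> complex_norm_square[of S'] by (simp add: mult.commute power2_eq_square field_simps)
  finally have phase: "inverse (complex_of_real (cmod S)) * S * S' = cmod S'" .
  have "1 / sqrt (n * r) = 1 / sqrt (a * t) * (1 / sqrt (n * p)) * cmod S'"
    using pos by (simp add: norm_S' real_sqrt_mult real_sqrt_divide field_simps)
  then have "(n * r) powr (- 1 / 2) = (a * t) powr (- 1 / 2) * (n * p) powr (- 1 / 2) * cmod S'"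
    using pos by (simp only: powr_minus_half mult_pos_pos)
  then have normalisation: "complex_of_real ((n * r) powr (- 1 / 2)) =
      complex_of_real ((a * t) powr (- 1 / 2)) * complex_of_real ((n * p) powr (- 1 / 2)) *
      (inverse (complex_of_real (cmod S)) * S * S')"
    by (simp only: phase of_real_mult)
  have "transport A \<psi> L N f x = complex_of_real ((n * r) powr (- 1 / 2)) * smear L f x"
    by (simp add: transport_eq_smear sizes Int_commute)
  moreover have "transport A \<psi> L M (transport A \<psi> M N f) x =
      complex_of_real ((a * t) powr (- 1 / 2)) * (complex_of_real ((n * p) powr (- 1 / 2)) *
        (S' * smear L f x))"
    by (simp add: transport_eq_smear smear_scale smear_smear[OF L M N f] S'_def sizes Int_commute)
  ultimately show ?thesis
    by (simp only: normalisation) (simp only: mult_ac)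
qed

section \<open>Action of the symplectic group\<close>

lemma Sp_compose:
  assumes "g \<in> Sp scale A" "h \<in> Sp scale A"
  shows "g \<circ> h \<in> Sp scale A"
  using assms by (auto simp: Sp_def bij_comp intro: Vector_Spaces.linear_compose)

lemma Sp_add: "g \<in> Sp scale A \<Longrightarrow> g (x + y) = g x + g y"
  using module_hom.add by (auto simp: Sp_def Vector_Spaces.linear_iff_module_hom)

lemma Sp_isometry: "g \<in> Sp scale A \<Longrightarrow> A (g x) (g y) = A x y"
  by (simp add: Sp_def)

lemma Sp_bij: "g \<in> Sp scale A \<Longrightarrow> bij g"
  by (simp add: Sp_def)

lemma translate_image:
  assumes "g \<in> Sp scale A"
  shows "translate g f (g x) = f x"
  using bij_is_inj[OF Sp_bij[OF assms]] by (simp add: translate_def)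

text \<open>As \<open>g\<close> is a bijective isometry, the defining identity may be tested at the
  points \<open>g x\<close>.\<close>

lemma translate_fibre_iff:
  assumes g: "g \<in> Sp scale A"
  shows "translate g f \<in> fibre A \<psi> (g ` L) \<longleftrightarrow> f \<in> fibre A \<psi> L"
proof -
  have all_image: "(\<forall>x. P x) \<longleftrightarrow> (\<forall>x. P (g x))" for P
    using bij_is_surj[OF Sp_bij[OF g]] by (metis surjD)
  show ?thesis
    using all_image[of "\<lambda>x. \<forall>y\<in>g ` L. translate g f (x + y) = \<psi> (A x y) * translate g f x"]
    by (simp add: fibre_def translate_image[OF g] Sp_isometry[OF g] Sp_add[OF g, symmetric])
qed

lemma translate_compose:
  assumes "g \<in> Sp scale A" "h \<in> Sp scale A"
  shows "translate g (translate h f) = translate (g \<circ> h) f"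
  using assms by (simp add: translate_def o_inv_distrib Sp_bij)

lemma translate_transport:
  assumes g: "g \<in> Sp scale A"
  shows "translate g (transport A \<psi> M L f) = transport A \<psi> (g ` M) (g ` L) (translate g f)"
proof
  fix y
  obtain x where y: "y = g x"
    using bij_is_surj[OF Sp_bij[OF g]] by (metis surjD)
  have inj: "inj_on g X" for X
    using bij_is_inj[OF Sp_bij[OF g]] by (rule inj_on_subset) simp
  have "g ` L \<inter> g ` M = g ` (L \<inter> M)"
    using inj[of UNIV] by (simp add: image_Int)
  then show "translate g (transport A \<psi> M L f) y = transport A \<psi> (g ` M) (g ` L) (translate g f) y"
    by (simp add: y translate_image[OF g] transport_def sum.reindex[OF inj] card_image[OF inj]
        Sp_isometry[OF g] Sp_add[OF g, symmetric])
qed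

lemma weil_rep_compose:
  assumes L: "lagrangian scale A L" and g: "g \<in> Sp scale A" and h: "h \<in> Sp scale A"
    and f: "f \<in> fibre A \<psi> L"
  defines "S \<equiv> gauss_sum A \<psi> L (g ` L) ((g \<circ> h) ` L)"
  shows "weil_rep A \<psi> L (g \<circ> h) f x =
    inverse (complex_of_real (cmod S)) * S * weil_rep A \<psi> L g (weil_rep A \<psi> L h f) x"
proof -
  note gh = Sp_compose[OF g h]
  have "g ` h ` L = (g \<circ> h) ` L"
    by (simp add: image_comp)
  then show ?thesis
    using transport_transport[OF L Sp_lagrangian[OF g L] Sp_lagrangian[OF gh L], of "translate (g \<circ> h) f" x]
      f translate_fibre_iff[OF gh]
    by (simp add: weil_rep_def translate_transport[OF g] translate_compose[OF g h] S_def)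
qed

section \<open>Uniqueness of the cocycle\<close>

lemma weil_rep_nonzero:
  assumes L: "lagrangian scale A L" and g: "g \<in> Sp scale A"
  shows "\<exists>f\<in>fibre A \<psi> L. weil_rep A \<psi> L g f 0 \<noteq> 0"
proof -
  note gL = Sp_lagrangian[OF g L]
  obtain f0 where f0: "f0 \<in> fibre A \<psi> L" "f0 0 \<noteq> 0"
    using fibre_nonzero[OF L] by blast
  define f where "f = (\<lambda>x. smear (g ` L) f0 (g x))"
  have tf: "translate g f = smear (g ` L) f0"
    using bij_is_surj[OF Sp_bij[OF g]] by (simp add: f_def translate_def surj_f_inv_f)
  have "f \<in> fibre A \<psi> L"
    using translate_fibre_iff[OF g, of f L] smear_in_fibre[OF gL] by (simp add: tf)
  moreover have "card (g ` L) \<noteq> 0" "card L \<noteq> 0" "card (L \<inter> g ` L) \<noteq> 0" "card (g ` L \<inter> L) \<noteq> 0"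
    using card_lagrangian_pos[OF gL] card_lagrangian_pos[OF L] card_Int_pos[OF L gL] card_Int_pos[OF gL L]
    by (simp_all only: neq0_conv)
  then have "weil_rep A \<psi> L g f 0 \<noteq> 0"
    using f0(2) by (simp del: card_eq_0_iff card_0_eq add: weil_rep_def tf transport_eq_smear smear_smear_fibre[OF L gL f0(1)])
  ultimately show ?thesis
    by blast
qed

text \<open>A vector with nonzero image under \<open>g \<circ> h\<close> determines the scalar, so
  the definite description has a unique candidate.\<close>

lemma weil_cocycle_eqI:
  assumes L: "lagrangian scale A L" and g: "g \<in> Sp scale A" and h: "h \<in> Sp scale A"
    and z: "multiplicativity_defect A \<psi> L g h z"
  shows "weil_cocycle A \<psi> L g h = z"
  unfolding weil_cocycle_def
proof (rule the_equality)
  show "multiplicativity_defect A \<psi> L g h z"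
    by (rule z)
next
  fix z'
  assume z': "multiplicativity_defect A \<psi> L g h z'"
  obtain f where f: "f \<in> fibre A \<psi> L" "weil_rep A \<psi> L (g \<circ> h) f 0 \<noteq> 0"
    using weil_rep_nonzero[OF L Sp_compose[OF g h]] by blast
  let ?w = "weil_rep A \<psi> L g (weil_rep A \<psi> L h f) 0"
  have "weil_rep A \<psi> L (g \<circ> h) f 0 = z * ?w" "weil_rep A \<psi> L (g \<circ> h) f 0 = z' * ?w"
    using z z' f(1) unfolding multiplicativity_defect_def by blast+
  then show "z' = z"
    using f(2) by auto
qed

end

theorem proposition5:
  fixes scale :: "'k::{field,finite} \<Rightarrow> 'w::{ab_group_add,finite} \<Rightarrow> 'w"
    and A :: "'w \<Rightarrow> 'w \<Rightarrow> 'k"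
    and \<psi> :: "'k \<Rightarrow> complex"
    and Lo :: "'w set"
    and q m :: nat
  assumes "CARD('k) = q" and "odd q"
    and "nontrivial_additive_character \<psi>"
    and "symplectic_space scale A"
    and "vector_space.dim scale (UNIV :: 'w set) = 2 * m"
    and "lagrangian scale A Lo"
  shows "\<forall>g \<in> Sp scale A. \<forall>h \<in> Sp scale A.
    multiplicativity_defect A \<psi> Lo g h (weil_cocycle A \<psi> Lo g h) \<and>
    weil_cocycle A \<psi> Lo g h =
      inverse (complex_of_real (cmod (gauss_sum A \<psi> Lo (g ` Lo) ((g \<circ> h) ` Lo)))) *
      gauss_sum A \<psi> Lo (g ` Lo) ((g \<circ> h) ` Lo)"
proof -
  interpret symplectic_space scale A
    by (rule assms)
  interpret finite_weil scale A \<psi>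
    using assms two_neq_zero_of_odd_CARD[where 'k = 'k] by unfold_locales auto
  \<comment> \<open>The explicit phase satisfies the defect relation; uniqueness identifies it with
    \<open>weil_cocycle\<close>.\<close>
  have "multiplicativity_defect A \<psi> Lo g h
      (inverse (complex_of_real (cmod (gauss_sum A \<psi> Lo (g ` Lo) ((g \<circ> h) ` Lo)))) *
        gauss_sum A \<psi> Lo (g ` Lo) ((g \<circ> h) ` Lo))"
    if "g \<in> Sp scale A" "h \<in> Sp scale A" for g h
    using weil_rep_compose[OF assms(6) that] by (simp add: multiplicativity_defect_def)
  then show ?thesis
    using weil_cocycle_eqI[OF assms(6)] by metis
qed

end
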